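(* Let $X\in\mathbb{R}^{m\times n}$ be a nonzero matrix of rank $r=r(X)$ with thin singular value decomposition $X=U\Sigma V^T$, where $U\in\mathbb{R}^{m\times r}$ and $V\in\mathbb{R}^{n\times r}$ have orthonormal columns and $\Sigma=\mathrm{diag}(\sigma_1,\dots,\sigma_r)$ with $\sigma_1\ge\dots\ge\sigma_r>0$, and let $V_\bot\in\mathbb{R}^{n\times(n-r)}$ be such that $[V,V_\bot]$ is orthogonal. Then $C\in\mathbb{R}^{n\times n}$ is a representation matrix of $X$ (i.e. $X=XC$) if and only if $$C=VV^T+V_\bot H$$ for some matrix $H\in\mathbb{R}^{(n-r)\times n}$. Thus every representation matrix $C$ satisfies $r(C)\ge r(X)$ and $\|C\|_*\ge r(X)$. Furthermore, for a representation matrix $C=VV^T+V_\bot H$: (a) If $C$ is symmetric, then $H=SV_\bot^T$, that is, $C=VV^T+V_\bot SV_\bot^T$, with a symmetric $S$. (b) If $\mathrm{tr}(C)=0$, then $r(C)\ge r(X)+1$.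
   Context: $r(\cdot)$ denotes the rank of a matrix, $\|\cdot\|_*$ the nuclear norm (sum of singular values), and $\mathrm{tr}$ the trace. If $r=n$, $V_\bot$ is empty and the term $V_\bot H$ is zero. *)

theory Defs
  imports
    Complex_Main
    "Jordan_Normal_Form.Char_Poly"
    "Jordan_Normal_Form.DL_Rank"
begin

abbreviation mat_rank :: "real mat \<Rightarrow> nat"
  where "mat_rank A \<equiv> vec_space.rank (dim_row A) A"

definition mat_trace :: "real mat \<Rightarrow> real"
  where "mat_trace A = (\<Sum>i<dim_row A. A $$ (i, i))"

definition symmetric_matrix :: "real mat \<Rightarrow> bool"
  where "symmetric_matrix A \<longleftrightarrow> square_mat A \<and> A\<^sup>T = A"

definition orthonormal_cols :: "real mat \<Rightarrow> bool"
  where "orthonormal_cols A \<longleftrightarrow> A\<^sup>T * A = 1\<^sub>m (dim_col A)"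

(* The library predicate orthogonal_mat only requires the columns to be nonzero and
   pairwise orthogonal. Here the inverse has to be the transpose. *)
definition real_orthogonal_mat :: "real mat \<Rightarrow> bool"
  where "real_orthogonal_mat Q \<longleftrightarrow>
    square_mat Q \<and> Q\<^sup>T * Q = 1\<^sub>m (dim_row Q) \<and> Q * Q\<^sup>T = 1\<^sub>m (dim_row Q)"

(* The block matrix [A, B]; column counterpart of append_rows. *)
definition append_cols :: "real mat \<Rightarrow> real mat \<Rightarrow> real mat"
  where "append_cols A B =
    four_block_mat A B (0\<^sub>m 0 (dim_col A)) (0\<^sub>m 0 (dim_col B))"

(* Square roots of the eigenvalues of the positive semidefinite matrix A^T A, counted
   with algebraic multiplicity. All these eigenvalues are real, so the multiset
   has dim_col A elements; it may contain more zeros than the convention with min(m, n)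
   singular values, which does not affect their sum. *)
definition singular_values :: "real mat \<Rightarrow> real multiset"
  where "singular_values A = image_mset sqrt (proots (char_poly (A\<^sup>T * A)))"

definition nuclear_norm :: "real mat \<Rightarrow> real"
  where "nuclear_norm A = sum_mset (singular_values A)"

(* Thin singular value decomposition; the singular values are
   \<sigma> 0, ..., \<sigma> (r - 1), and the values of \<sigma> from r on are irrelevant. *)
definition thin_svd ::
  "real mat \<Rightarrow> nat \<Rightarrow> real mat \<Rightarrow> (nat \<Rightarrow> real) \<Rightarrow> real mat \<Rightarrow> bool"
  where "thin_svd X r U \<sigma> V \<longleftrightarrow>
    U \<in> carrier_mat (dim_row X) r \<and> V \<in> carrier_mat (dim_col X) r \<and>
    orthonormal_cols U \<and> orthonormal_cols V \<and>
    (\<forall>i j. i \<le> j \<and> j < r \<longrightarrow> \<sigma> j \<le> \<sigma> i) \<and> (\<forall>i<r. 0 < \<sigma> i) \<and>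
    X = U * mat_diag r \<sigma> * V\<^sup>T"

definition representation_matrix :: "real mat \<Rightarrow> real mat \<Rightarrow> bool"
  where "representation_matrix X C \<longleftrightarrow>
    C \<in> carrier_mat (dim_col X) (dim_col X) \<and> X = X * C"

end

(* Cancelling the left factors of the decomposition turns X = X C into V^T C = V^T, which
   describes all the representation matrices and is the only property of C used afterwards.

   Rank: if C = B D has inner dimension k, then (V^T B) (D V) = V^T C V = 1, so r <= k. If
   k = r, the two factors are inverse to each other, so V^T C W = V^T W = 0 forces D W = 0 for
   the complement W of V, hence C W = 0 and tr C = tr (V^T C V) = r > 0.

   Nuclear norm: with R = V V^T we have tr (R C) = tr R = r. In an orthonormal eigenbasis p_i
   of C^T C, with eigenvalues d_i = |C p_i|^2, this trace is the sum of the inner products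
   of R p_i and C p_i, each of which is at most sqrt d_i because R is an orthogonal projection. *)
theory Submission
  imports Defs "HOL-Analysis.L2_Norm"
begin

section \<open>Traces of products\<close>

lemma mat_trace_mult_comm:
  assumes "A \<in> carrier_mat n k" "B \<in> carrier_mat k n"
  shows "mat_trace (A * B) = mat_trace (B * A)"
proof -
  have "mat_trace (A * B) = (\<Sum>i<n. \<Sum>j<k. A $$ (i, j) * B $$ (j, i))"
    using assms by (auto simp: mat_trace_def scalar_prod_def lessThan_atLeast0 intro!: sum.cong)
  also have "\<dots> = (\<Sum>j<k. \<Sum>i<n. B $$ (j, i) * A $$ (i, j))"
    by (subst sum.swap) (simp add: mult.commute)
  also have "\<dots> = mat_trace (B * A)"
    using assms by (auto simp: mat_trace_def scalar_prod_def lessThan_atLeast0 intro!: sum.cong)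
  finally show ?thesis .
qed

lemma mat_trace_one [simp]: "mat_trace (1\<^sub>m n) = real n"
  by (simp add: mat_trace_def)

section \<open>Eigenvectors of real symmetric matrices and Householder reflections\<close>

text \<open>Here \<open>q\<close> is the Hermitian form w^* A w and \<open>s\<close> the squared
  norm of \<open>w\<close>, so \<open>q = \<mu> * s\<close>. Since \<open>A\<close> is real
  symmetric, \<open>q\<close> is real, and \<open>s\<close> is real and nonzero.\<close>

lemma real_symmetric_eigenvalue_real:
  fixes A :: "real mat"
  assumes A: "A \<in> carrier_mat n n" and sym: "A\<^sup>T = A"
    and ev: "eigenvalue (map_mat complex_of_real A) \<mu>"
  shows "\<mu> \<in> \<real>"
proof -
  from ev obtain w where w: "w \<in> carrier_vec n" and w0: "w \<noteq> 0\<^sub>v n"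
    and Aw: "map_mat complex_of_real A *\<^sub>v w = \<mu> \<cdot>\<^sub>v w"
    using A by (auto simp: eigenvalue_def eigenvector_def)
  have Aji: "A $$ (j, i) = A $$ (i, j)" if "i < n" "j < n" for i j
    using that A sym by (metis carrier_matD index_transpose_mat(1))
  have row: "(\<Sum>j<n. A $$ (i, j) * w $ j) = \<mu> * w $ i" if "i < n" for i
  proof -
    have "(\<mu> \<cdot>\<^sub>v w) $ i = (map_mat complex_of_real A *\<^sub>v w) $ i" using Aw by simp
    also have "\<dots> = (\<Sum>j<n. A $$ (i, j) * w $ j)"
      using that A w by (auto simp: scalar_prod_def lessThan_atLeast0 intro!: sum.cong)
    finally show ?thesis using that w by simp
  qed
  define q where "q = (\<Sum>i<n. \<Sum>j<n. A $$ (i, j) * w $ j * cnj (w $ i))"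
  define s where "s = (\<Sum>i<n. w $ i * cnj (w $ i))"
  have "q = (\<Sum>i<n. (\<Sum>j<n. A $$ (i, j) * w $ j) * cnj (w $ i))"
    by (simp add: q_def sum_distrib_right)
  also have "\<dots> = \<mu> * s" by (simp add: row s_def sum_distrib_left mult.assoc)
  finally have q: "q = \<mu> * s" .
  \<comment> \<open>Conjugation fixes the real entries of \<open>A\<close>; exchanging the two sums
    and using symmetry then restores \<open>q\<close>.\<close>
  have "cnj q = (\<Sum>i<n. \<Sum>j<n. A $$ (i, j) * cnj (w $ j) * w $ i)"
    by (simp add: q_def)
  also have "\<dots> = (\<Sum>j<n. \<Sum>i<n. A $$ (i, j) * cnj (w $ j) * w $ i)"
    by (rule sum.swap)
  also have "\<dots> = q"
    unfolding q_def by (intro sum.cong refl) (simp add: Aji mult_ac)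
  finally have "cnj q = q" .
  moreover have "cnj s = s" by (simp add: s_def mult.commute)
  ultimately have "cnj \<mu> * s = \<mu> * s" using q by (metis complex_cnj_mult)
  moreover have "s \<noteq> 0"
  proof -
    from w w0 obtain i where i: "i < n" "w $ i \<noteq> 0" by (metis eq_vecI carrier_vecD index_zero_vec)
    have "s = of_real (\<Sum>i<n. (cmod (w $ i))\<^sup>2)"
      by (simp only: s_def complex_norm_square[symmetric] of_real_sum)
    moreover have "(\<Sum>i<n. (cmod (w $ i))\<^sup>2) > 0"
      by (rule sum_pos2[of _ i]) (use i in auto)
    ultimately show ?thesis by (metis less_irrefl of_real_eq_0_iff)
  qed
  ultimately show ?thesis by (simp add: Reals_cnj_iff)
qed

text \<open>The fundamental theorem of algebra gives a complex eigenvalue. It is real by the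
  previous lemma, hence a root of the real characteristic polynomial, and so it has a real
  eigenvector.\<close>

lemma real_symmetric_eigenvector_ex:
  fixes A :: "real mat"
  assumes A: "A \<in> carrier_mat n n" and sym: "A\<^sup>T = A" and n: "n > 0"
  obtains e v where "eigenvector A v e"
proof -
  let ?Ac = "map_mat complex_of_real A"
  have Ac: "?Ac \<in> carrier_mat n n" using A by simp
  have "degree (char_poly ?Ac) = n" using degree_monic_char_poly[OF Ac] by simp
  with n have "\<not> constant (poly (char_poly ?Ac))" by (simp add: constant_degree)
  then obtain \<mu> where root: "poly (char_poly ?Ac) \<mu> = 0"
    using fundamental_theorem_of_algebra by blast
  hence "eigenvalue ?Ac \<mu>" using eigenvalue_root_char_poly[OF Ac] by simp
  from real_symmetric_eigenvalue_real[OF A sym this] obtain e where \<mu>: "\<mu> = of_real e"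
    by (auto elim: Reals_cases)
  from root have "poly (map_poly complex_of_real (char_poly A)) (of_real e) = 0"
    by (simp add: of_real_hom.char_poly_hom[OF A] \<mu>)
  hence "poly (char_poly A) e = 0" by (simp add: of_real_hom.poly_map_poly)
  hence "eigenvalue A e" using eigenvalue_root_char_poly[OF A] by simp
  thus thesis using that by (auto simp: eigenvalue_def)
qed

(* W is the Householder reflection exchanging v and the first unit vector; for u = 0 it is the
   identity, because x / 0 = 0. *)
lemma orthogonal_mat_with_first_col:
  fixes v :: "real vec"
  assumes v: "v \<in> carrier_vec n" and unit: "v \<bullet> v = 1" and n: "n > 0"
  obtains W where "W \<in> carrier_mat n n" "W\<^sup>T * W = 1\<^sub>m n" "col W 0 = v"
proof -
  define u where "u i = v $ i - (if i = 0 then 1 else 0)" for i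
  define c where "c = (\<Sum>i<n. u i * u i)"
  define w where "w i j = (if i = j then 1 else 0) - 2 * u i * u j / c" for i j
  define W where "W = mat n n (\<lambda>(i, j). w i j)"
  have W: "W \<in> carrier_mat n n" by (simp add: W_def)
  have vv: "(\<Sum>i<n. v $ i * v $ i) = 1"
    using unit v by (simp add: scalar_prod_def lessThan_atLeast0)
  \<comment> \<open>The squared norm of v - e_0, a difference of two unit vectors, is 2 - 2 v_0 = -2
    u_0. For nonzero \<open>c\<close> this turns column 0 of the reflection, e_0 - (2 u_0 / c) u,
    into e_0 + u = v.\<close>
  have "c = (\<Sum>i<n. v $ i * v $ i - 2 * (if i = 0 then v $ i else 0) + (if i = 0 then 1 else 0))"
    unfolding c_def u_def by (intro sum.cong) (auto simp: algebra_simps)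
  also have "\<dots> = 2 - 2 * v $ 0"
    using n by (simp add: sum.distrib sum_subtractf vv sum_distrib_left[symmetric])
  finally have c: "c = - 2 * u 0" by (simp add: u_def)
  have wcol: "w i 0 = v $ i" if "i < n" for i
  proof (cases "c = 0")
    case True
    hence "u i = 0" using that unfolding c_def
      by (subst (asm) sum_nonneg_eq_0_iff) auto
    thus ?thesis by (simp add: w_def u_def split: if_splits)
  next
    case False
    hence "2 * u i * u 0 / c = - u i" using c by (simp add: field_simps)
    thus ?thesis by (simp add: w_def u_def)
  qed
  have ww: "(\<Sum>k<n. w k i * w k j) = (if i = j then 1 else 0)" if ij: "i < n" "j < n" for i j
  proof -
    \<comment> \<open>The two mixed terms contribute -4 u_i u_j / c in total, and the quadratic term
      cancels this because the squares of the u_k sum to \<open>c\<close>.\<close>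
    have "(\<Sum>k<n. w k i * w k j) =
      (\<Sum>k<n. (if k = i then (if i = j then 1 else 0) else 0) - (if k = i then 2 * u i * u j / c else 0)
        - (if k = j then 2 * u i * u j / c else 0) + 4 * u i * u j / (c * c) * (u k * u k))"
      unfolding w_def by (intro sum.cong) (auto simp: algebra_simps)
    also have "\<dots> = (if i = j then 1 else 0) - 4 * u i * u j / c + 4 * u i * u j / (c * c) * c"
      using ij unfolding sum.distrib sum_distrib_left[symmetric] c_def[symmetric]
      by (simp add: sum_subtractf)
    finally show ?thesis by (cases "c = 0") (simp_all add: field_simps)
  qed
  have "W\<^sup>T * W = 1\<^sub>m n"
    by (rule eq_matI) (auto simp: W_def scalar_prod_def lessThan_atLeast0[symmetric] ww)
  moreover have "col W 0 = v"
    by (rule eq_vecI) (use v n in \<open>auto simp: W_def wcol\<close>)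
  ultimately show thesis using that W by blast
qed

section \<open>Rank factorizations and inner dimensions\<close>

text \<open>The columns of \<open>B\<close> form a maximal linearly independent set of columns of
  \<open>A\<close>, whose size is the rank. They span all columns of \<open>A\<close>, and
  \<open>D\<close> collects the coefficients.\<close>

lemma (in vec_space) rank_factorization:
  assumes A: "A \<in> carrier_mat n nc"
  obtains B D where "B \<in> carrier_mat n (rank A)" "D \<in> carrier_mat (rank A) nc" "A = B * D"
proof -
  let ?P = "\<lambda>T. T \<subseteq> set (cols A) \<and> lin_indpt T"
  have Acols: "set (cols A) \<subseteq> carrier_vec n" using cols_dim A by blast
  obtain S where S: "finite S" "maximal S ?P"
    using maximal_exists_superset[of "set (cols A)" ?P "{}"] finite_lin_indpt2 by auto
  have rank: "rank A = card S" by (rule rank_card_indpt[OF A S(2)])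
  have SA: "S \<subseteq> set (cols A)" and indpt: "lin_indpt S"
    using S(2) by (auto simp: maximal_def)
  hence Sn: "S \<subseteq> carrier_vec n" using Acols by blast
  \<comment> \<open>By maximality of \<open>S\<close>: a column outside the span could be added
    without losing independence.\<close>
  have span: "c \<in> span S" if c: "c \<in> set (cols A)" for c
  proof (rule ccontr)
    assume ns: "c \<notin> span S"
    have "lin_indpt (S \<union> {c})"
      using lin_dep_iff_in_span[OF Sn indpt, of c] ns c Acols span_mem[OF Sn, of c] by auto
    moreover have "c \<notin> S" using ns span_mem[OF Sn] by auto
    ultimately show False using S(2) SA c unfolding maximal_def by blast
  qed
  obtain xs where xs: "set xs = S" "distinct xs"
    using finite_distinct_list[OF S(1)] by blast
  define B where "B = mat_of_cols n xs"
  have colsB: "cols B = xs" unfolding B_def by (rule cols_mat_of_cols) (use xs Sn in auto)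
  have len: "length xs = rank A" using rank xs distinct_card by metis
  have B: "B \<in> carrier_mat n (rank A)" unfolding B_def using len by auto
  have "\<exists>d \<in> carrier_vec (rank A). col A i = B *\<^sub>v d" if i: "i < nc" for i
  proof -
    have "col A i \<in> span S"
      using i A by (intro span) (auto simp: cols_def)
    then obtain a where "col A i = lincomb a S"
      using finite_span[OF S(1) Sn] by auto
    also have "\<dots> = B *\<^sub>v vec (rank A) (\<lambda>i. a (col B i))"
      using mat_mult_eq_lincomb[OF B, of a] colsB xs by simp
    finally show ?thesis by (intro bexI) auto
  qed
  then obtain d where d: "\<And>i. i < nc \<Longrightarrow> d i \<in> carrier_vec (rank A) \<and> col A i = B *\<^sub>v d i"
    by metis
  define D where "D = mat_of_cols (rank A) (map d [0..<nc])"
  have D: "D \<in> carrier_mat (rank A) nc" 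
    using mat_of_cols_carrier(1)[of "rank A" "map d [0..<nc]"] by (simp add: D_def)
  have colD: "col D i = d i" if "i < nc" for i
    unfolding D_def using that d[OF that] by (subst col_mat_of_cols) auto
  have "A = B * D"
  proof (rule eq_matI)
    fix i j assume ij: "i < dim_row (B * D)" "j < dim_col (B * D)"
    hence ij': "i < n" "j < nc" using B D by auto
    have "A $$ (i, j) = col A j $ i" using ij' A by simp
    also have "\<dots> = (B *\<^sub>v d j) $ i" using d[OF ij'(2)] by simp
    also have "\<dots> = (B * D) $$ (i, j)" using ij ij' B colD[OF ij'(2)] by simp
    finally show "A $$ (i, j) = (B * D) $$ (i, j)" .
  qed (use A B D in auto)
  with B D that show thesis by blast
qed

text \<open>If \<open>k < r\<close>, padding \<open>P\<close> with zero columns and \<open>Q\<close>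
  with zero rows gives square matrices with the same product. A one-sided inverse of a square matrix
  is two-sided, so the reversed product is the identity too, yet it has a zero on its
  diagonal.\<close>

lemma one_mat_mult_inner_dim_le:
  fixes P Q :: "'a :: field mat"
  assumes P: "P \<in> carrier_mat r k" and Q: "Q \<in> carrier_mat k r" and PQ: "P * Q = 1\<^sub>m r"
  shows "r \<le> k"
proof (rule ccontr)
  assume "\<not> r \<le> k"
  hence kr: "k < r" by simp
  define P' where "P' = mat r r (\<lambda>(i, j). if j < k then P $$ (i, j) else 0)"
  define Q' where "Q' = mat r r (\<lambda>(i, j). if i < k then Q $$ (i, j) else 0)"
  have P': "P' \<in> carrier_mat r r" and Q': "Q' \<in> carrier_mat r r"
    by (simp_all add: P'_def Q'_def)
  have "P' * Q' = P * Q"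
  proof (rule eq_matI)
    fix i j assume "i < dim_row (P * Q)" "j < dim_col (P * Q)"
    hence ij: "i < r" "j < r" using P Q by auto
    have "(P' * Q') $$ (i, j) =
        (\<Sum>l<r. (if l < k then P $$ (i, l) else 0) * (if l < k then Q $$ (l, j) else 0))"
      using ij by (auto simp: P'_def Q'_def scalar_prod_def lessThan_atLeast0 intro!: sum.cong)
    also have "\<dots> = (\<Sum>l<k. P $$ (i, l) * Q $$ (l, j))"
      using kr by (intro sum.mono_neutral_cong_right) auto
    also have "\<dots> = (P * Q) $$ (i, j)"
      using ij P Q by (auto simp: scalar_prod_def lessThan_atLeast0 intro!: sum.cong)
    finally show "(P' * Q') $$ (i, j) = (P * Q) $$ (i, j)" .
  qed (use P Q P' Q' in auto)
  hence 1: "Q' * P' = 1\<^sub>m r" using PQ by (intro mat_mult_left_right_inverse[OF P' Q']) simp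
  \<comment> \<open>Index \<open>k\<close> is the first padded one, so row \<open>k\<close> of
    \<open>Q'\<close> is zero.\<close>
  have "(Q' * P') $$ (k, k) = 0"
    using kr by (simp add: P'_def Q'_def scalar_prod_def)
  thus False using 1 kr by simp
qed

section \<open>Orthogonal diagonalization of real symmetric matrices\<close>

text \<open>Deflation: conjugation by an orthogonal matrix whose first column is a unit eigenvector
  clears the rest of the first column, and by symmetry the rest of the first row. The remaining
  block is again symmetric and one size smaller.\<close>

theorem real_symmetric_diagonalization:
  fixes A :: "real mat"
  assumes "A \<in> carrier_mat n n" and "A\<^sup>T = A"
  shows "\<exists>P d. P \<in> carrier_mat n n \<and> P\<^sup>T * P = 1\<^sub>m n \<and> P\<^sup>T * A * P = mat_diag n d"
  using assms
proof (induction n arbitrary: A)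
  case 0
  show ?case
    by (intro exI[of _ "1\<^sub>m 0"] exI[of _ "\<lambda>_. 0"]) (use 0 in \<open>auto simp: mat_diag_def\<close>)
next
  case (Suc k)
  let ?n = "Suc k"
  note A = Suc.prems(1) and sym = Suc.prems(2)
  obtain e w where "eigenvector A w e"
    using real_symmetric_eigenvector_ex[OF A sym zero_less_Suc] by blast
  hence w: "w \<in> carrier_vec ?n" "w \<noteq> 0\<^sub>v ?n" "A *\<^sub>v w = e \<cdot>\<^sub>v w"
    using A by (auto simp: eigenvector_def)
  have ww: "w \<bullet> w > 0" using conjugate_square_greater_0_vec[OF w(1)] w(2) by simp
  define v where "v = (1 / sqrt (w \<bullet> w)) \<cdot>\<^sub>v w"
  have v: "v \<in> carrier_vec ?n" using w by (simp add: v_def)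
  have vv: "v \<bullet> v = 1" using ww w by (simp add: v_def)
  have Av: "A *\<^sub>v v = e \<cdot>\<^sub>v v"
    using w A by (simp add: v_def mult_mat_vec smult_smult_assoc mult.commute)
  obtain W where W: "W \<in> carrier_mat ?n ?n" "W\<^sup>T * W = 1\<^sub>m ?n" "col W 0 = v"
    using orthogonal_mat_with_first_col[OF v vv] by auto
  define A' where "A' = W\<^sup>T * A * W"
  have A': "A' \<in> carrier_mat ?n ?n" using A W by (simp add: A'_def)
  have "A'\<^sup>T = W\<^sup>T * (W\<^sup>T * A)\<^sup>T"
    unfolding A'_def by (rule transpose_mult) (use A W in auto)
  also have "(W\<^sup>T * A)\<^sup>T = A\<^sup>T * W"
    by (subst transpose_mult) (use A W in auto)
  also have "W\<^sup>T * (A\<^sup>T * W) = A'"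
    using A W sym by (simp add: A'_def)
  finally have A'sym: "A'\<^sup>T = A'" .
  \<comment> \<open>Column 0 of \<open>W\<close> is the eigenvector \<open>v\<close>, so column 0 of
    \<open>A * W\<close> is \<open>e\<close> times it, and orthonormality of the columns of
    \<open>W\<close> leaves \<open>e\<close> in the top entry only.\<close>
  have colA': "A' $$ (i, 0) = (if i = 0 then e else 0)" if i: "i < ?n" for i
  proof -
    have "A' = W\<^sup>T * (A * W)" using A W by (simp add: A'_def)
    hence "A' $$ (i, 0) = row (W\<^sup>T) i \<bullet> col (A * W) 0" using i A W(1) by simp
    also have "col (A * W) 0 = A *\<^sub>v col W 0" by (rule col_mult2[OF A W(1)]) simp
    also have "\<dots> = e \<cdot>\<^sub>v col W 0" using W(3) Av by simp
    also have "row (W\<^sup>T) i \<bullet> \<dots> = e * (W\<^sup>T * W) $$ (i, 0)" using i W(1) by simp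
    finally show ?thesis using i W(2) by simp
  qed
  have A'ji: "A' $$ (i, j) = A' $$ (j, i)" if "i < ?n" "j < ?n" for i j
    using that A' A'sym by (metis carrier_matD index_transpose_mat(1))
  define B where "B = mat k k (\<lambda>(i, j). A' $$ (Suc i, Suc j))"
  have B: "B \<in> carrier_mat k k" by (simp add: B_def)
  have Bsym: "B\<^sup>T = B" by (rule eq_matI) (auto simp: B_def intro: A'ji)
  let ?e = "mat 1 1 (\<lambda>_. e)"
  have A'block: "A' = four_block_mat ?e (0\<^sub>m 1 k) (0\<^sub>m k 1) B"
  proof (rule eq_matI)
    fix i j assume "i < dim_row (four_block_mat ?e (0\<^sub>m 1 k) (0\<^sub>m k 1) B)"
      "j < dim_col (four_block_mat ?e (0\<^sub>m 1 k) (0\<^sub>m k 1) B)"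
    hence "i < ?n" "j < ?n" using B by auto
    thus "A' $$ (i, j) = four_block_mat ?e (0\<^sub>m 1 k) (0\<^sub>m k 1) B $$ (i, j)"
      using B colA' A'ji[of 0 j] by (cases i; cases j) (auto simp: B_def)
  qed (use A' B in auto)
  obtain Q d where Q: "Q \<in> carrier_mat k k" "Q\<^sup>T * Q = 1\<^sub>m k" "Q\<^sup>T * B * Q = mat_diag k d"
    using Suc.IH[OF B Bsym] by blast
  \<comment> \<open>The block diagonal matrix with blocks 1 and \<open>Q\<close> keeps the split-off
    eigenvalue and diagonalizes the rest; \<open>W * F\<close> is the required witness.\<close>
  define F where "F = four_block_mat (1\<^sub>m 1) (0\<^sub>m 1 k) (0\<^sub>m k 1) Q"
  have F: "F \<in> carrier_mat ?n ?n" using Q unfolding F_def by (metis four_block_carrier_mat one_carrier_mat plus_1_eq_Suc)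
  have FT: "F\<^sup>T = four_block_mat (1\<^sub>m 1) (0\<^sub>m 1 k) (0\<^sub>m k 1) (Q\<^sup>T)"
    using Q(1) unfolding F_def by (subst transpose_four_block_mat) (auto simp: transpose_one)
  have FF: "F\<^sup>T * F = 1\<^sub>m ?n"
    unfolding FT unfolding F_def
    by (subst mult_four_block_mat[OF one_carrier_mat zero_carrier_mat zero_carrier_mat _ one_carrier_mat zero_carrier_mat zero_carrier_mat])
       (use Q in \<open>auto\<close>)
  \<comment> \<open>The eigenvalues of the smaller block move up by one index to make room for
    \<open>e\<close>.\<close>
  define d' where "d' i = (if i = 0 then e else d (i - 1))" for i
  have "F\<^sup>T * A' = four_block_mat ?e (0\<^sub>m 1 k) (0\<^sub>m k 1) (Q\<^sup>T * B)"
    unfolding FT A'block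
    by (subst mult_four_block_mat[where ?nr1.0 = 1 and ?n1.0 = 1 and ?n2.0 = k and ?nr2.0 = k and ?nc1.0 = 1 and ?nc2.0 = k])
       (use Q B in \<open>auto\<close>)
  also have "\<dots> * F = four_block_mat ?e (0\<^sub>m 1 k) (0\<^sub>m k 1) (Q\<^sup>T * B * Q)"
    unfolding F_def
    by (subst mult_four_block_mat[where ?nr1.0 = 1 and ?n1.0 = 1 and ?n2.0 = k and ?nr2.0 = k and ?nc1.0 = 1 and ?nc2.0 = k])
       (use Q B in \<open>auto\<close>)
  also have "\<dots> = mat_diag ?n d'"
    unfolding Q(3) by (rule eq_matI) (auto simp: mat_diag_def d'_def)
  finally have FAF: "F\<^sup>T * A' * F = mat_diag ?n d'" .
  have PT: "(W * F)\<^sup>T = F\<^sup>T * W\<^sup>T" using W F by (simp add: transpose_mult)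
  have "(W * F)\<^sup>T * (W * F) = F\<^sup>T * (W\<^sup>T * W) * F"
    using W(1) F unfolding PT by (simp add: assoc_mult_mat[of _ ?n ?n _ ?n _ ?n])
  hence "(W * F)\<^sup>T * (W * F) = 1\<^sub>m ?n" using W(2) FF F by simp
  moreover have "(W * F)\<^sup>T * A * (W * F) = F\<^sup>T * A' * F"
    using W(1) F A unfolding PT A'_def by (simp add: assoc_mult_mat[of _ ?n ?n _ ?n _ ?n])
  ultimately show ?case using FAF W(1) F mult_carrier_mat by metis
qed

section \<open>Nuclear norm and trace inequality\<close>

lemma proots_prod_list_linear:
  "proots (\<Prod>a\<leftarrow>as. [:- a, 1:]) = mset (as :: 'a :: idom list)"
proof (induction as)
  case (Cons a as)
  have "(\<Prod>a\<leftarrow>as. [:- a, 1:]) \<noteq> 0" by (auto simp: prod_list_zero_iff)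
  hence "proots ([:- a, 1:] * (\<Prod>a\<leftarrow>as. [:- a, 1:])) = {#a#} + mset as"
    by (subst proots_mult) (simp_all add: Cons)
  thus ?case by simp
qed simp

text \<open>As \<open>P\<close> is square, its transpose is a two-sided inverse, so C^T C is similar
  to the diagonal matrix and has the same characteristic polynomial. This connects the definition
  through polynomial roots with an arbitrary orthonormal eigenbasis.\<close>

lemma nuclear_norm_eq:
  assumes C: "C \<in> carrier_mat m n" and P: "P \<in> carrier_mat n n" "P\<^sup>T * P = 1\<^sub>m n"
    and D: "P\<^sup>T * (C\<^sup>T * C) * P = mat_diag n d"
  shows "nuclear_norm C = (\<Sum>i<n. sqrt (d i))"
proof -
  have PP: "P * P\<^sup>T = 1\<^sub>m n" using mat_mult_left_right_inverse[of "P\<^sup>T" n P] P by simp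
  have CC: "C\<^sup>T * C \<in> carrier_mat n n" using C by simp
  have "P * mat_diag n d * P\<^sup>T = (P * P\<^sup>T) * (C\<^sup>T * C) * (P * P\<^sup>T)"
    unfolding D[symmetric] using CC P(1) by (simp add: assoc_mult_mat[of _ n n _ n _ n])
  hence "C\<^sup>T * C = P * mat_diag n d * P\<^sup>T"
    by (simp only: PP left_mult_one_mat[OF CC] right_mult_one_mat[OF CC])
  hence "similar_mat (C\<^sup>T * C) (mat_diag n d)"
    unfolding similar_mat_def similar_mat_wit_def Let_def using P PP CC
    by (intro exI[of _ P] exI[of _ "P\<^sup>T"]) auto
  hence "char_poly (C\<^sup>T * C) = char_poly (mat_diag n d)" by (rule char_poly_similar)
  also have "\<dots> = (\<Prod>a\<leftarrow>diag_mat (mat_diag n d). [:- a, 1:])"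
    by (rule char_poly_upper_triangular[of _ n]) (auto simp: mat_diag_def upper_triangular_def)
  finally have "proots (char_poly (C\<^sup>T * C)) = mset (diag_mat (mat_diag n d))"
    by (simp only: proots_prod_list_linear)
  also have "diag_mat (mat_diag n d) = map d [0..<n]"
    by (auto simp: diag_mat_def mat_diag_def)
  finally show ?thesis
    by (simp add: nuclear_norm_def singular_values_def sum_unfold_sum_mset
        image_mset.compositionality comp_def lessThan_atLeast0)
qed

text \<open>Diagonal entries of such products are inner products of columns, so this is the
  Cauchy-Schwarz inequality for the \<open>i\<close>-th columns, in a form that fits the matrix
  algebra below.\<close>

lemma cauchy_schwarz_gram:
  fixes M N :: "real mat"
  assumes "M \<in> carrier_mat m n" "N \<in> carrier_mat m n" "i < n"
  shows "((M\<^sup>T * N) $$ (i, i))\<^sup>2 \<le> (M\<^sup>T * M) $$ (i, i) * (N\<^sup>T * N) $$ (i, i)"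
proof -
  have *: "(X\<^sup>T * Y) $$ (i, i) = (\<Sum>k<m. X $$ (k, i) * Y $$ (k, i))"
    if "X \<in> carrier_mat m n" "Y \<in> carrier_mat m n" for X Y :: "real mat"
    using that assms(3) by (auto simp: scalar_prod_def lessThan_atLeast0 intro!: sum.cong)
  let ?f = "\<lambda>k. M $$ (k, i)" and ?g = "\<lambda>k. N $$ (k, i)"
  have "\<bar>\<Sum>k<m. ?f k * ?g k\<bar> \<le> L2_set ?f {..<m} * L2_set ?g {..<m}"
    using L2_set_mult_ineq[of ?f ?g "{..<m}"]
    by (intro order_trans[OF sum_abs]) (simp add: abs_mult)
  hence "\<bar>\<Sum>k<m. ?f k * ?g k\<bar>\<^sup>2 \<le> (L2_set ?f {..<m} * L2_set ?g {..<m})\<^sup>2"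
    by (intro power_mono) auto
  thus ?thesis
    unfolding *[OF assms(1,2)] *[OF assms(1,1)] *[OF assms(2,2)]
    by (simp add: L2_set_def power_mult_distrib sum_nonneg power2_eq_square[symmetric])
qed

lemma trace_proj_mult_le_nuclear_norm:
  assumes C: "C \<in> carrier_mat n n" and R: "R \<in> carrier_mat n n"
    and sym: "R\<^sup>T = R" and idem: "R * R = R"
  shows "mat_trace (R * C) \<le> nuclear_norm C"
proof -
  have CC: "C\<^sup>T * C \<in> carrier_mat n n" using C by simp
  have "(C\<^sup>T * C)\<^sup>T = C\<^sup>T * C" using C by (subst transpose_mult) auto
  from real_symmetric_diagonalization[OF CC this] obtain P d where P: "P \<in> carrier_mat n n"
    "P\<^sup>T * P = 1\<^sub>m n" and D: "P\<^sup>T * (C\<^sup>T * C) * P = mat_diag n d" by blast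
  have PP: "P * P\<^sup>T = 1\<^sub>m n" using mat_mult_left_right_inverse[of "P\<^sup>T" n P] P by simp
  note assoc = assoc_mult_mat[of _ n n _ n _ n]
  define M N where "M = R * P" and "N = C * P"
  have M: "M \<in> carrier_mat n n" and N: "N \<in> carrier_mat n n"
    using R C P(1) by (auto simp: M_def N_def)
  have MT: "M\<^sup>T = P\<^sup>T * R" unfolding M_def using R P(1) sym by (subst transpose_mult) auto
  have NT: "N\<^sup>T = P\<^sup>T * C\<^sup>T" unfolding N_def using C P(1) by (subst transpose_mult) auto
  have NN: "N\<^sup>T * N = mat_diag n d"
    unfolding NT D[symmetric] unfolding N_def using C P(1) by (simp add: assoc)
  \<comment> \<open>Symmetry and idempotence of \<open>R\<close> give |R p_i|^2 = (R p_i) . p_i for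
    every column p_i of \<open>P\<close>.\<close>
  have "R * (R * P) = R * P" using assoc[OF R R P(1)] idem by simp
  hence MM: "M\<^sup>T * M = M\<^sup>T * P"
    unfolding MT unfolding M_def using R P(1) by (simp add: assoc)
  have le: "(M\<^sup>T * N) $$ (i, i) \<le> sqrt (d i)" if i: "i < n" for i
  proof -
    define a where "a = (M\<^sup>T * M) $$ (i, i)"
    \<comment> \<open>Cauchy-Schwarz for R p_i and the unit vector p_i: the squared length
      \<open>a\<close> of the projected vector satisfies this inequality and is therefore at most
      1.\<close>
    have "a\<^sup>2 \<le> a" using cauchy_schwarz_gram[OF M P(1) i] P(2) i by (simp add: MM a_def)
    hence "a \<le> 1" using mult_left_mono[of 1 a a] by (cases "a \<le> 1") (auto simp: power2_eq_square)
    have dN: "d i = (N\<^sup>T * N) $$ (i, i)" using i by (simp add: NN mat_diag_def)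
    have "0 \<le> d i"
      unfolding dN using N i by (auto simp: scalar_prod_def intro!: sum_nonneg)
    have "((M\<^sup>T * N) $$ (i, i))\<^sup>2 \<le> a * d i"
      using cauchy_schwarz_gram[OF M N i] by (simp add: a_def dN)
    also have "\<dots> \<le> 1 * d i" using \<open>a \<le> 1\<close> \<open>0 \<le> d i\<close> by (intro mult_right_mono)
    finally show ?thesis by (simp add: real_le_rsqrt)
  qed
  \<comment> \<open>Inserting \<open>P * P\<^sup>T\<close> and cycling the trace rewrites it in the
    eigenbasis formed by the columns of \<open>P\<close>.\<close>
  have "mat_trace (R * C) = mat_trace (R * C * (P * P\<^sup>T))" using R C by (simp add: PP)
  also have "R * C * (P * P\<^sup>T) = (R * C * P) * P\<^sup>T" using R C P(1) by (simp add: assoc)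
  also have "mat_trace \<dots> = mat_trace (P\<^sup>T * (R * C * P))"
    by (rule mat_trace_mult_comm) (use R C P(1) in auto)
  also have "P\<^sup>T * (R * C * P) = M\<^sup>T * N"
    unfolding MT unfolding N_def using R C P(1) by (simp add: assoc)
  also have "mat_trace (M\<^sup>T * N) = (\<Sum>i<n. (M\<^sup>T * N) $$ (i, i))"
    using M by (simp add: mat_trace_def)
  also have "\<dots> \<le> (\<Sum>i<n. sqrt (d i))" by (intro sum_mono le) simp
  also have "\<dots> = nuclear_norm C" using nuclear_norm_eq[OF C P D] by simp
  finally show ?thesis .
qed

section \<open>Orthogonal complements and cancellation in the singular value decomposition\<close>

text \<open>The first three identities are blocks of Q^T Q = 1, read off from the columns of Q =
  [V, W]. The last one is Q Q^T = 1, where each row of Q is a row of \<open>V\<close> followed by a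
  row of \<open>W\<close>.\<close>

lemma real_orthogonal_append_cols:
  assumes V: "V \<in> carrier_mat n r" and W: "W \<in> carrier_mat n s"
    and orth: "real_orthogonal_mat (append_cols V W)"
  shows "V\<^sup>T * V = 1\<^sub>m r" "V\<^sup>T * W = 0\<^sub>m r s" "W\<^sup>T * W = 1\<^sub>m s" "V * V\<^sup>T + W * W\<^sup>T = 1\<^sub>m n"
proof -
  let ?Q = "append_cols V W"
  have Q: "?Q \<in> carrier_mat n (r + s)"
    using V W unfolding append_cols_def by (intro carrier_matI) auto
  \<comment> \<open>Squareness is part of orthogonality; it keeps the column indices
    \<open>r + i\<close> below \<open>n\<close>.\<close>
  hence n: "n = r + s" using orth by (auto simp: real_orthogonal_mat_def)
  have QTQ: "?Q\<^sup>T * ?Q = 1\<^sub>m n" and QQT: "?Q * ?Q\<^sup>T = 1\<^sub>m n"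
    using orth Q by (auto simp: real_orthogonal_mat_def)
  have colV: "col ?Q i = col V i" if "i < r" for i
    using that V W n by (intro eq_vecI) (auto simp: append_cols_def)
  have colW: "col ?Q (r + i) = col W i" if "i < s" for i
    using that V W n by (intro eq_vecI) (auto simp: append_cols_def)
  have rowQ: "row ?Q i = row V i @\<^sub>v row W i" if "i < n" for i
    using that V W n by (intro eq_vecI) (auto simp: append_cols_def)
  have ent: "col ?Q i \<bullet> col ?Q j = (if i = j then 1 else 0)" if "i < n" "j < n" for i j
  proof -
    have "col ?Q i \<bullet> col ?Q j = (?Q\<^sup>T * ?Q) $$ (i, j)" using that Q n by simp
    thus ?thesis using QTQ that by simp
  qed
  show "V\<^sup>T * V = 1\<^sub>m r"
    by (rule eq_matI) (use V n ent in \<open>auto simp flip: colV\<close>)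
  show "V\<^sup>T * W = 0\<^sub>m r s"
    by (rule eq_matI) (use V W n ent in \<open>auto simp flip: colV colW\<close>)
  show "W\<^sup>T * W = 1\<^sub>m s"
    by (rule eq_matI) (use W n ent in \<open>auto simp flip: colW\<close>)
  show "V * V\<^sup>T + W * W\<^sup>T = 1\<^sub>m n"
  proof (rule eq_matI)
    fix i j assume "i < dim_row (1\<^sub>m n :: real mat)" "j < dim_col (1\<^sub>m n :: real mat)"
    hence ij: "i < n" "j < n" by auto
    have "(1\<^sub>m n :: real mat) $$ (i, j) = (?Q * ?Q\<^sup>T) $$ (i, j)" by (simp only: QQT)
    also have "\<dots> = row ?Q i \<bullet> row ?Q j" using ij Q by simp
    also have "\<dots> = row V i \<bullet> row V j + row W i \<bullet> row W j"
      unfolding rowQ[OF ij(1)] rowQ[OF ij(2)]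
      by (rule scalar_prod_append[of _ r _ s]) (use V W ij in auto)
    also have "\<dots> = (V * V\<^sup>T + W * W\<^sup>T) $$ (i, j)" using ij V W by simp
    finally show "(V * V\<^sup>T + W * W\<^sup>T) $$ (i, j) = (1\<^sub>m n :: real mat) $$ (i, j)" ..
  qed (use V W in auto)
qed

text \<open>The matrix \<open>?L\<close>, which is \<Sigma>^(-1) U^T, is a left inverse of U
  \<Sigma>, so multiplying X = X C by it cancels these factors. Multiplying back by U \<Sigma> gives
  the converse.\<close>

lemma representation_matrix_iff_right_factor:
  assumes X: "X \<in> carrier_mat m n" and svd: "thin_svd X r U \<sigma> V" and C: "C \<in> carrier_mat n n"
  shows "representation_matrix X C \<longleftrightarrow> V\<^sup>T * C = V\<^sup>T"
proof -
  have U: "U \<in> carrier_mat m r" and V: "V \<in> carrier_mat n r" and UU: "U\<^sup>T * U = 1\<^sub>m r"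
    and pos: "\<And>i. i < r \<Longrightarrow> 0 < \<sigma> i" and X_eq: "X = U * mat_diag r \<sigma> * V\<^sup>T"
    using svd X by (auto simp: thin_svd_def orthonormal_cols_def)
  have VT: "V\<^sup>T \<in> carrier_mat r n" using V by simp
  have S: "mat_diag r \<sigma> \<in> carrier_mat r r" by simp
  let ?L = "mat_diag r (\<lambda>i. 1 / \<sigma> i) * U\<^sup>T"
  have L: "?L \<in> carrier_mat r m" using U by (intro mult_carrier_mat[of _ r r]) auto
  have diag: "mat_diag r (\<lambda>i. 1 / \<sigma> i * \<sigma> i) = 1\<^sub>m r"
    by (rule eq_matI) (use pos in \<open>force simp: mat_diag_def\<close>)+
  have "?L * U = mat_diag r (\<lambda>i. 1 / \<sigma> i) * (U\<^sup>T * U)"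
    by (rule assoc_mult_mat[of _ r r _ m _ r]) (use U in auto)
  also have "\<dots> = mat_diag r (\<lambda>i. 1 / \<sigma> i)"
    unfolding UU by (rule right_mult_one_mat[of _ r r]) simp
  finally have LU: "?L * U = mat_diag r (\<lambda>i. 1 / \<sigma> i)" .
  have "?L * X = ?L * (U * mat_diag r \<sigma>) * V\<^sup>T"
    unfolding X_eq by (rule assoc_mult_mat[of _ r m _ r _ n, symmetric]) (use L U VT in auto)
  also have "?L * (U * mat_diag r \<sigma>) = ?L * U * mat_diag r \<sigma>"
    by (rule assoc_mult_mat[of _ r m _ r _ r, symmetric]) (use L U in auto)
  also have "\<dots> = 1\<^sub>m r" unfolding LU mat_diag_diag diag ..
  finally have LX: "?L * X = V\<^sup>T" using VT by simp
  show ?thesis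
  proof
    assume "representation_matrix X C"
    hence "X = X * C" by (simp add: representation_matrix_def)
    hence "?L * X * C = ?L * X" using assoc_mult_mat[OF L X C] by simp
    thus "V\<^sup>T * C = V\<^sup>T" unfolding LX .
  next
    assume "V\<^sup>T * C = V\<^sup>T"
    moreover have "X * C = U * mat_diag r \<sigma> * (V\<^sup>T * C)"
      unfolding X_eq by (rule assoc_mult_mat[of _ m r _ n _ n]) (use U VT C in auto)
    ultimately have "X * C = X" using X_eq by simp
    thus "representation_matrix X C"
      using X C by (simp add: representation_matrix_def)
  qed
qed

text \<open>With C = B D this exposes \<open>C\<close> inside a product of the two compressed
  factors, as in (V^T B) (D V) = V^T C V.\<close>

lemma mult_mat_regroup:
  assumes "A \<in> carrier_mat a b" "B \<in> carrier_mat b c" "D \<in> carrier_mat c d" "E \<in> carrier_mat d e"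
  shows "(A * B) * (D * E) = A * (B * D) * E"
  using assms by (simp add: assoc_mult_mat[of _ a b _ c _ e] assoc_mult_mat[of _ a b _ d _ e]
    assoc_mult_mat[of _ b c _ d _ e])

section \<open>Rank, nuclear norm and trace of matrices with
  \<open>V\<^sup>T * C = V\<^sup>T\<close>\<close>

lemma fixing_cols_rank_ge:
  assumes V: "V \<in> carrier_mat n r" and VV: "V\<^sup>T * V = 1\<^sub>m r"
    and C: "C \<in> carrier_mat n n" and VC: "V\<^sup>T * C = V\<^sup>T"
  shows "r \<le> mat_rank C"
proof -
  have dim: "dim_row C = n" using C by simp
  obtain B D where BD: "B \<in> carrier_mat n (mat_rank C)" "D \<in> carrier_mat (mat_rank C) n" "C = B * D"
    using vec_space.rank_factorization[OF C] unfolding dim by blast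
  have "(V\<^sup>T * B) * (D * V) = V\<^sup>T * (B * D) * V"
    by (rule mult_mat_regroup) (use V BD(1,2) in auto)
  also have "\<dots> = 1\<^sub>m r" unfolding BD(3)[symmetric] VC VV ..
  finally show ?thesis using V BD by (intro one_mat_mult_inner_dim_le) auto
qed

text \<open>The trace inequality is applied to the orthogonal projection V V^T, for which tr (V V^T
  C) = tr (V V^T) = tr (V^T V) = r.\<close>

lemma fixing_cols_nuclear_norm_ge:
  assumes V: "V \<in> carrier_mat n r" and VV: "V\<^sup>T * V = 1\<^sub>m r"
    and C: "C \<in> carrier_mat n n" and VC: "V\<^sup>T * C = V\<^sup>T"
  shows "real r \<le> nuclear_norm C"
proof -
  let ?R = "V * V\<^sup>T"
  have R: "?R \<in> carrier_mat n n" using V by simp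
  have "?R * ?R = V * (V\<^sup>T * V) * V\<^sup>T"
    using V by (simp add: assoc_mult_mat[of _ n r _ n _ n] assoc_mult_mat[of _ r n _ r _ n]
       assoc_mult_mat[of _ n r _ r _ n])
  hence idem: "?R * ?R = ?R" using V VV by simp
  have sym: "?R\<^sup>T = ?R" using V by (subst transpose_mult) auto
  have "?R * C = V * (V\<^sup>T * C)" using V C by simp
  hence "mat_trace (?R * C) = mat_trace (V\<^sup>T * V)"
    using V by (simp add: VC mat_trace_mult_comm[of V n r])
  thus ?thesis using trace_proj_mult_le_nuclear_norm[OF C R sym idem] VV by simp
qed

lemma fixing_cols_trace_zero_rank:
  assumes V: "V \<in> carrier_mat n r" and W: "W \<in> carrier_mat n s"
    and VV: "V\<^sup>T * V = 1\<^sub>m r" and VW: "V\<^sup>T * W = 0\<^sub>m r s"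
    and id: "V * V\<^sup>T + W * W\<^sup>T = 1\<^sub>m n"
    and C: "C \<in> carrier_mat n n" and VC: "V\<^sup>T * C = V\<^sup>T"
    and tr: "mat_trace C = 0" and r: "r > 0"
  shows "r + 1 \<le> mat_rank C"
proof (rule ccontr)
  assume "\<not> r + 1 \<le> mat_rank C"
  hence rank: "mat_rank C = r" using fixing_cols_rank_ge[OF V VV C VC] by simp
  have dim: "dim_row C = n" using C by simp
  obtain B D where B: "B \<in> carrier_mat n r" and D: "D \<in> carrier_mat r n" and BD: "C = B * D"
    using vec_space.rank_factorization[OF C, unfolded rank[unfolded dim]] by blast
  have VB: "V\<^sup>T * B \<in> carrier_mat r r" and DV: "D * V \<in> carrier_mat r r"
    and DW: "D * W \<in> carrier_mat r s" using V W B D by auto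
  have *: "(V\<^sup>T * B) * (D * Z) = V\<^sup>T * Z" if Z: "Z \<in> carrier_mat n k" for Z k
  proof -
    have "(V\<^sup>T * B) * (D * Z) = V\<^sup>T * (B * D) * Z"
      by (rule mult_mat_regroup) (use V B D Z in auto)
    thus ?thesis by (simp only: BD[symmetric] VC)
  qed
  have "(V\<^sup>T * B) * (D * V) = 1\<^sub>m r" using *[OF V] VV by simp
  \<comment> \<open>Under the assumption that the rank is \<open>r\<close>, both compressed factors
    are square, so the inverse works on either side.\<close>
  hence inv: "(D * V) * (V\<^sup>T * B) = 1\<^sub>m r" by (rule mat_mult_left_right_inverse[OF VB DV])
  have "D * W = (D * V) * (V\<^sup>T * B) * (D * W)" unfolding inv using left_mult_one_mat[OF DW] by simp
  also have "\<dots> = (D * V) * ((V\<^sup>T * B) * (D * W))" by (rule assoc_mult_mat[OF DV VB DW])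
  also have "\<dots> = 0\<^sub>m r s" unfolding *[OF W] VW by (rule right_mult_zero_mat[OF DV])
  finally have "C * W = 0\<^sub>m n s" unfolding BD using B D W by simp
  hence CWW: "C * (W * W\<^sup>T) = 0\<^sub>m n n"
    using assoc_mult_mat[of C n n W s "W\<^sup>T" n] C W by simp
  \<comment> \<open>As \<open>C\<close> annihilates the columns of \<open>W\<close>, only the part C
    V V^T survives, and cycling its trace gives \<open>r\<close>.\<close>
  have "C = C * (V * V\<^sup>T + W * W\<^sup>T)" unfolding id using C by simp
  also have "\<dots> = C * (V * V\<^sup>T) + C * (W * W\<^sup>T)"
    by (rule mult_add_distrib_mat[of _ n n _ n]) (use C V W in auto)
  also have "\<dots> = (C * V) * V\<^sup>T" unfolding CWW using C V by simp
  finally have "mat_trace C = mat_trace ((C * V) * V\<^sup>T)" by simp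
  also have "\<dots> = mat_trace (V\<^sup>T * (C * V))"
    by (rule mat_trace_mult_comm) (use C V in auto)
  also have "V\<^sup>T * (C * V) = 1\<^sub>m r"
    using assoc_mult_mat[of "V\<^sup>T" r n C n V r] C V VC VV by simp
  finally show False using tr r by simp
qed

section \<open>Characterization of representation matrices and its consequences\<close>

theorem lemma3:
  fixes X U V Vp :: "real mat" and \<sigma> :: "nat \<Rightarrow> real" and m n r :: nat
  assumes "X \<in> carrier_mat m n"
    and "X \<noteq> 0\<^sub>m m n"
    and "r = mat_rank X"
    and "thin_svd X r U \<sigma> V"
    and "Vp \<in> carrier_mat n (n - r)"
    and "real_orthogonal_mat (append_cols V Vp)"
  shows
    "(\<forall>C \<in> carrier_mat n n.
        representation_matrix X C \<longleftrightarrow>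
        (\<exists>H \<in> carrier_mat (n - r) n. C = V * V\<^sup>T + Vp * H)) \<and>
     (\<forall>C. representation_matrix X C \<longrightarrow>
        mat_rank X \<le> mat_rank C \<and> real (mat_rank X) \<le> nuclear_norm C) \<and>
     (\<forall>C. \<forall>H \<in> carrier_mat (n - r) n.
        representation_matrix X C \<and> C = V * V\<^sup>T + Vp * H \<longrightarrow>
        (symmetric_matrix C \<longrightarrow>
          (\<exists>S \<in> carrier_mat (n - r) (n - r). symmetric_matrix S \<and>
             H = S * Vp\<^sup>T \<and> C = V * V\<^sup>T + Vp * S * Vp\<^sup>T)) \<and>
        (mat_trace C = 0 \<longrightarrow> mat_rank X + 1 \<le> mat_rank C))"
proof -
  note X = assms(1) and Vp = assms(5)
  \<comment> \<open>Orthogonality of [V, Vp] forces \<open>n = r + s\<close>, so the truncated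
    subtraction is exact. For \<open>r = n\<close> the matrices \<open>Vp\<close> and
    \<open>H\<close> are empty and their product is the zero matrix.\<close>
  define s where "s = n - r"
  have W: "Vp \<in> carrier_mat n s" using Vp by (simp add: s_def)
  have U: "U \<in> carrier_mat m r" and V: "V \<in> carrier_mat n r"
    and X_eq: "X = U * mat_diag r \<sigma> * V\<^sup>T"
    using assms(4) X by (auto simp: thin_svd_def)
  note [simp] = s_def[symmetric]
  note VV = real_orthogonal_append_cols(1)[OF V W assms(6)]
  note VW = real_orthogonal_append_cols(2)[OF V W assms(6)]
  note WW = real_orthogonal_append_cols(3)[OF V W assms(6)]
  note id = real_orthogonal_append_cols(4)[OF V W assms(6)]
  have VT: "V\<^sup>T \<in> carrier_mat r n" and WT: "Vp\<^sup>T \<in> carrier_mat s n" using V W by auto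
  have WV: "Vp\<^sup>T * V = 0\<^sub>m s r"
    using arg_cong[OF VW, of transpose_mat] V W by (simp add: transpose_mult[of _ r n])
  note rep = representation_matrix_iff_right_factor[OF X assms(4)]
  have carrier: "C \<in> carrier_mat n n" if "representation_matrix X C" for C
    using that X by (simp add: representation_matrix_def)
  \<comment> \<open>This is where \<open>X\<close> being nonzero enters; it makes a trace equal to
    \<open>r\<close> contradict trace zero.\<close>
  have r: "r > 0"
  proof (rule ccontr)
    assume "\<not> r > 0"
    hence "X = 0\<^sub>m m n"
      unfolding X_eq using U V by (intro eq_matI) (auto simp: scalar_prod_def)
    thus False using assms(2) by simp
  qed
  \<comment> \<open>Multiplying the resolution of the identity by \<open>C\<close> from the right
    supplies the witness \<open>Vp\<^sup>T * C\<close> for \<open>H\<close>.\<close>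
  have split: "V\<^sup>T * C = V\<^sup>T \<Longrightarrow> C = V * V\<^sup>T + Vp * (Vp\<^sup>T * C)" if C: "C \<in> carrier_mat n n" for C
  proof -
    assume VC: "V\<^sup>T * C = V\<^sup>T"
    have "C = (V * V\<^sup>T + Vp * Vp\<^sup>T) * C" unfolding id using C by simp
    also have "\<dots> = V * V\<^sup>T * C + Vp * Vp\<^sup>T * C"
      by (rule add_mult_distrib_mat[of _ n n]) (use C V W in auto)
    also have "\<dots> = V * (V\<^sup>T * C) + Vp * (Vp\<^sup>T * C)"
      using C V W by simp
    finally show ?thesis unfolding VC .
  qed
  have fixes_V: "V\<^sup>T * (V * V\<^sup>T + Vp * H) = V\<^sup>T" if H: "H \<in> carrier_mat s n" for H
  proof -
    have "V\<^sup>T * (V * V\<^sup>T + Vp * H) = V\<^sup>T * (V * V\<^sup>T) + V\<^sup>T * (Vp * H)"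
      by (rule mult_add_distrib_mat[of _ r n _ n]) (use V W H in auto)
    also have "\<dots> = V\<^sup>T * V * V\<^sup>T + V\<^sup>T * Vp * H"
      using V W H by (simp add: assoc_mult_mat[of _ r n _ r _ n] assoc_mult_mat[of _ r n _ s _ n])
    also have "\<dots> = V\<^sup>T" unfolding VV VW using VT H by simp
    finally show ?thesis .
  qed
  have 1: "representation_matrix X C \<longleftrightarrow> (\<exists>H \<in> carrier_mat s n. C = V * V\<^sup>T + Vp * H)"
    if C: "C \<in> carrier_mat n n" for C
    using rep[OF C] split[OF C] fixes_V WT C mult_carrier_mat by metis
  have 2: "r \<le> mat_rank C \<and> real r \<le> nuclear_norm C" if "representation_matrix X C" for C
    using that carrier[OF that] rep fixing_cols_rank_ge[OF V VV] fixing_cols_nuclear_norm_ge[OF V VV]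
    by blast
  have 3: "\<exists>S \<in> carrier_mat s s. symmetric_matrix S \<and> H = S * Vp\<^sup>T \<and> C = V * V\<^sup>T + Vp * S * Vp\<^sup>T"
    if H: "H \<in> carrier_mat s n" and R: "representation_matrix X C"
      and C_eq: "C = V * V\<^sup>T + Vp * H" and sym: "symmetric_matrix C" for C H
  proof -
    have C: "C \<in> carrier_mat n n" and VC: "V\<^sup>T * C = V\<^sup>T" using carrier[OF R] rep R by auto
    have CT: "C\<^sup>T = C" using sym by (simp add: symmetric_matrix_def)
    \<comment> \<open>The transpose of \<open>V\<^sup>T * C = V\<^sup>T\<close>: for symmetric
      \<open>C\<close> the columns of \<open>V\<close> are fixed from the other side too.\<close>
    have CV: "C * V = V"
      using arg_cong[OF VC, of transpose_mat] C V CT by (simp add: transpose_mult[of _ r n])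
    have "Vp\<^sup>T * C = Vp\<^sup>T * (V * V\<^sup>T) + Vp\<^sup>T * (Vp * H)"
      unfolding C_eq by (rule mult_add_distrib_mat[of _ s n _ n]) (use V W H in auto)
    also have "\<dots> = Vp\<^sup>T * V * V\<^sup>T + Vp\<^sup>T * Vp * H"
      using V W H by (simp add: assoc_mult_mat[of _ s n _ r _ n] assoc_mult_mat[of _ s n _ s _ n])
    also have "\<dots> = H" unfolding WV WW using V H by simp
    finally have WC: "Vp\<^sup>T * C = H" .
    \<comment> \<open>By \<open>WC\<close> this is Vp^T C Vp, the compression of \<open>C\<close> to
      the complement, which inherits symmetry from \<open>C\<close>.\<close>
    define S where "S = H * Vp"
    have S: "S \<in> carrier_mat s s" using H W by (simp add: S_def)
    have "H\<^sup>T = C * Vp"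
      unfolding WC[symmetric] using C W CT by (subst transpose_mult[of _ s n]) auto
    hence "S\<^sup>T = Vp\<^sup>T * (C * Vp)"
      unfolding S_def using transpose_mult[OF H W] by simp
    also have "\<dots> = S" unfolding S_def WC[symmetric] using C W by simp
    finally have "S\<^sup>T = S" .
    hence symS: "symmetric_matrix S" using S by (simp add: symmetric_matrix_def)
    have "H * V = Vp\<^sup>T * (C * V)" unfolding WC[symmetric] using C V W by simp
    hence HV: "H * V = 0\<^sub>m s r" by (simp add: CV WV)
    \<comment> \<open>Splitting the identity on the right of \<open>H\<close> leaves only the part
      along \<open>Vp\<close>, because \<open>H * V\<close> vanishes.\<close>
    have "H = H * (V * V\<^sup>T + Vp * Vp\<^sup>T)" unfolding id using H by simp
    also have "\<dots> = H * (V * V\<^sup>T) + H * (Vp * Vp\<^sup>T)"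
      by (rule mult_add_distrib_mat[of _ s n _ n]) (use H V W in auto)
    also have "\<dots> = H * V * V\<^sup>T + S * Vp\<^sup>T"
      using H V W by (simp add: S_def assoc_mult_mat[of _ s n _ r _ n] assoc_mult_mat[of _ s n _ s _ n])
    also have "\<dots> = S * Vp\<^sup>T" unfolding HV using V S WT by simp
    finally have HS: "H = S * Vp\<^sup>T" .
    hence "C = V * V\<^sup>T + Vp * S * Vp\<^sup>T" using C_eq S W by simp
    with S symS HS show ?thesis by blast
  qed
  have 4: "r + 1 \<le> mat_rank C" if "representation_matrix X C" "mat_trace C = 0" for C
    using fixing_cols_trace_zero_rank[OF V W VV VW id _ _ _ r] carrier rep that by blast
  show ?thesis
    using 1 2 3 4 unfolding assms(3)[symmetric] s_def by blast
qed

end
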